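(* Let $p$ be a prime and let $M = p^{a}$, $N = p^{b}$ with integers $a,b \ge 1$. Then the sequence $b(n) = \mathcal{B}_{M,N}(n) \bmod M$ ($n \ge 0$) is purely periodic, and its minimal period is $P_{\min} = p^{e}$, where $t = \lceil a/b \rceil$ and $e = at - b(t-1)$.
   Context: For integers $M\ge 2$, $N \ge 1$ and $n\ge 0$ with base-$M$ expansion $n=\sum_{i\ge 0} d_i(n) M^i$, $d_i(n)\in\{0,\dots,M-1\}$, the base-shifting map is $\mathcal{B}_{M,N}(n) := \sum_{i\ge 0} d_i(n) N^i$. *)

theory Defs
  imports Complex_Main "HOL-Computational_Algebra.Primes" "HOL-Library.Groups_Big_Fun"
begin

definition digit :: "nat \<Rightarrow> nat \<Rightarrow> nat \<Rightarrow> nat" where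
  "digit M i n = (n div M ^ i) mod M"

text \<open>\<^const>\<open>Sum_any\<close> adds up the finitely many nonzero terms; it would collapse to \<open>0\<close> if there
  were infinitely many, which cannot happen for \<open>M \<ge> 2\<close>.\<close>

definition base_shift :: "nat \<Rightarrow> nat \<Rightarrow> nat \<Rightarrow> nat" where
  "base_shift M N n = Sum_any (\<lambda>i. digit M i n * N ^ i)"

definition is_period :: "(nat \<Rightarrow> 'a) \<Rightarrow> nat \<Rightarrow> bool" where
  "is_period f P \<longleftrightarrow> P > 0 \<and> (\<forall>n. f (n + P) = f n)"

definition purely_periodic :: "(nat \<Rightarrow> 'a) \<Rightarrow> bool" where
  "purely_periodic f \<longleftrightarrow> (\<exists>P. is_period f P)"

text \<open>Unspecified unless \<open>f\<close> is purely periodic.\<close>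

definition minimal_period :: "(nat \<Rightarrow> 'a) \<Rightarrow> nat" where
  "minimal_period f = (LEAST P. is_period f P)"

end

(* Since N^i vanishes modulo M = p^a exactly for i >= t, only the digits d_0, ..., d_(t-1) matter,
   and the last one only modulo p^(a - b(t-1)); hence p^e is a period and the minimal period is a
   power of p dividing it. It is not p^(e-1) or a divisor: p^(e-1) has the single nonzero digit
   p^(a - b(t-1) - 1) in position t-1 and is therefore sent to p^(a-1), whereas 0 is sent to 0. *)
theory Submission
  imports Defs "HOL-Number_Theory.Cong"
begin

lemma is_period_mult:
  assumes "is_period f P" "k > 0"
  shows "is_period f (P * k)"
proof -
  have "f (n + P * k) = f n" for n
  proof (induction k)
    case (Suc k)
    have "f (n + P * Suc k) = f (n + P * k + P)" by (simp add: algebra_simps)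
    with Suc show ?case using assms(1) by (simp add: is_period_def)
  qed simp
  with assms show ?thesis by (simp add: is_period_def)
qed

lemma is_period_minimal_period:
  "purely_periodic f \<Longrightarrow> is_period f (minimal_period f)"
  unfolding purely_periodic_def minimal_period_def by (metis LeastI)

text \<open>Division with remainder: a positive remainder of \<open>Q\<close> modulo the least
  period would be a smaller period.\<close>

lemma minimal_period_dvd:
  assumes "is_period f Q"
  shows "minimal_period f dvd Q"
proof (rule ccontr)
  define L where "L = minimal_period f"
  have L: "is_period f L"
    using is_period_minimal_period assms unfolding L_def purely_periodic_def by blast
  assume "\<not> minimal_period f dvd Q"
  then have pos: "Q mod L > 0" by (simp add: L_def mod_greater_zero_iff_not_dvd)
  have "f (n + Q mod L) = f n" for n
  \<comment> \<open>A period must be positive, so \<open>L * (Q div L)\<close> counts as one only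
    when the quotient is nonzero.\<close>
  proof (cases "Q div L = 0")
    case True
    then have "Q mod L = Q" by (metis add_0 div_mult_mod_eq mult_0)
    then show ?thesis using assms by (simp add: is_period_def)
  next
    case False
    then have "f (n + Q mod L) = f (n + Q mod L + L * (Q div L))"
      using is_period_mult[OF L, of "Q div L"] unfolding is_period_def by (metis gr0I)
    also have "\<dots> = f (n + Q)" by (simp only: add.assoc mod_mult_div_eq)
    finally show ?thesis using assms by (simp add: is_period_def)
  qed
  with pos have "is_period f (Q mod L)" by (simp add: is_period_def)
  then have "L \<le> Q mod L" unfolding L_def minimal_period_def by (rule Least_le)
  moreover have "Q mod L < L" using L by (simp add: is_period_def)
  ultimately show False by simp
qed

text \<open>The minimal period divides \<open>p ^ Suc k\<close>, so it is some \<open>p ^ j\<close>;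
  with \<open>j \<le> k\<close> its multiple \<open>p ^ k\<close> would be a period too.\<close>

lemma minimal_period_prime_power:
  fixes p :: nat
  assumes "prime p" and period: "is_period f (p ^ Suc k)" and not_period: "\<not> is_period f (p ^ k)"
  shows "minimal_period f = p ^ Suc k"
proof -
  obtain j where j: "j \<le> Suc k" "minimal_period f = p ^ j"
    using minimal_period_dvd[OF period] divides_primepow_nat[OF \<open>prime p\<close>] by blast
  have "is_period f (p ^ j)"
    using is_period_minimal_period period j(2) unfolding purely_periodic_def by metis
  then have "is_period f (p ^ (j + d))" for d
    using is_period_mult[of f "p ^ j" "p ^ d"] \<open>prime p\<close> by (simp add: power_add prime_gt_0_nat)
  then have "\<not> j \<le> k" using not_period by (metis le_add_diff_inverse)
  with j show ?thesis by (metis le_antisym not_less_eq_eq)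
qed

lemma digit_eq_0: "n < M ^ i \<Longrightarrow> digit M i n = 0"
  by (simp add: digit_def)

lemma base_shift_eq_sum:
  assumes "n < M ^ K" "M \<ge> 2"
  shows "base_shift M N n = (\<Sum>i<K. digit M i n * N ^ i)"
proof -
  have "digit M i n = 0" if "\<not> i < K" for i
  proof (rule digit_eq_0)
    have "M ^ K \<le> M ^ i" using that assms(2) by (intro power_increasing) auto
    with assms(1) show "n < M ^ i" by simp
  qed
  then have "{i. digit M i n * N ^ i \<noteq> 0} \<subseteq> {..<K}"
    by (metis (mono_tags, lifting) CollectD lessThan_iff mult_0 subsetI)
  then show ?thesis unfolding base_shift_def by (intro Sum_any.expand_superset) auto
qed

lemma base_shift_cong_sum:
  assumes "M \<ge> 2" and "M dvd N ^ t"
  shows "[base_shift M N n = (\<Sum>i<t. digit M i n * N ^ i)] (mod M)"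
proof -
  \<comment> \<open>The bound \<open>t + n\<close> is generous: it exceeds the number of digits of
    \<open>n\<close> and is at least \<open>t\<close>, so the sum can be split at
    \<open>t\<close>.\<close>
  have "n < M ^ (t + n)"
  proof -
    have "n < 2 ^ n" by simp
    also have "\<dots> \<le> M ^ n" using assms(1) by (intro power_mono) auto
    also have "\<dots> \<le> M ^ (t + n)" using assms(1) by (intro power_increasing) auto
    finally show ?thesis .
  qed
  then have "base_shift M N n = (\<Sum>i<t + n. digit M i n * N ^ i)"
    using assms(1) by (rule base_shift_eq_sum)
  also have "\<dots> = (\<Sum>i<t. digit M i n * N ^ i) + (\<Sum>i\<in>{t..<t + n}. digit M i n * N ^ i)"
    by (subst sum.union_disjoint[symmetric]) (auto intro!: sum.cong)
  finally have eq: "base_shift M N n = \<dots>" .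
  have "M dvd (\<Sum>i\<in>{t..<t + n}. digit M i n * N ^ i)"
  proof (intro dvd_sum dvd_mult)
    fix i assume "i \<in> {t..<t + n}"
    then have "N ^ t dvd N ^ i" by (intro le_imp_power_dvd) auto
    with assms(2) show "M dvd N ^ i" by (rule dvd_trans)
  qed
  then show ?thesis unfolding eq by (auto simp: cong_def elim!: dvdE)
qed

lemma digit_add_mult_power:
  assumes "M > 0"
  shows "digit M i (n + M ^ i * q) = (n div M ^ i + q) mod M"
  using assms by (simp add: digit_def add.commute)

text \<open>For \<open>i < s\<close> the summand is a multiple of \<open>M ^ Suc i\<close>, so after
  division by \<open>M ^ i\<close> it still vanishes modulo \<open>M\<close>.\<close>

lemma digit_add_of_less:
  assumes "M > 0" "i < s"
  shows "digit M i (n + M ^ s * q) = digit M i n"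
proof -
  have "M ^ s * q = M ^ i * (M * (M ^ (s - Suc i) * q))"
    using assms(2) by (simp flip: power_Suc power_add mult.assoc)
  then show ?thesis using assms(1) by (simp only: digit_add_mult_power) (simp add: digit_def)
qed

lemma digit_power_mult:
  assumes "q < M"
  shows "digit M i (M ^ s * q) = (if i = s then q else 0)"
proof (cases i s rule: linorder_cases)
  case less
  then show ?thesis using digit_add_of_less[of M i s 0 q] assms by (simp add: digit_def)
next
  case equal
  then show ?thesis using assms by (simp add: digit_def)
next
  case greater
  have "M ^ s * q < M ^ Suc s" using assms by simp
  also have "\<dots> \<le> M ^ i" using assms greater by (intro power_increasing) auto
  finally show ?thesis using greater by (simp add: digit_eq_0)
qed

text \<open>Evaluates the witness against the smaller period; \<open>q = 0\<close> gives the value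
  at 0.\<close>

lemma base_shift_power_mult:
  assumes "q < M" "M \<ge> 2"
  shows "base_shift M N (M ^ s * q) = q * N ^ s"
proof -
  have "M ^ s * q < M ^ Suc s" using assms by simp
  then have "base_shift M N (M ^ s * q) = (\<Sum>i<Suc s. digit M i (M ^ s * q) * N ^ i)"
    using assms(2) by (rule base_shift_eq_sum)
  then show ?thesis using assms(1) by (simp add: digit_power_mult)
qed

text \<open>Adding \<open>M ^ s * r\<close> keeps the digits below position \<open>s\<close> and
  raises digit \<open>s\<close> by \<open>r\<close> modulo \<open>M\<close>, which contributes a
  multiple of \<open>r * N ^ s = M\<close>. A carry reaches only positions beyond \<open>s\<close>,
  whose weights vanish modulo \<open>M\<close>.\<close>

lemma base_shift_period:
  assumes "M \<ge> 2" and M: "M = r * N ^ s" and "M dvd N ^ Suc s"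
  shows "is_period (\<lambda>n. base_shift M N n mod M) (M ^ s * r)"
proof -
  have "r > 0" using assms(1,2) by (cases r) auto
  have "[base_shift M N (n + M ^ s * r) = base_shift M N n] (mod M)" for n
  proof -
    have "[base_shift M N (n + M ^ s * r) = (\<Sum>i<Suc s. digit M i (n + M ^ s * r) * N ^ i)] (mod M)"
      by (rule base_shift_cong_sum) fact+
    also have "[(\<Sum>i<Suc s. digit M i (n + M ^ s * r) * N ^ i) = (\<Sum>i<Suc s. digit M i n * N ^ i)] (mod M)"
    proof (rule cong_sum)
      fix i assume "i \<in> {..<Suc s}"
      then consider "i < s" | "i = s" by fastforce
      then show "[digit M i (n + M ^ s * r) * N ^ i = digit M i n * N ^ i] (mod M)"
      proof cases
        case 1
        then show ?thesis using digit_add_of_less assms(1) by simp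
      next
        case 2
        \<comment> \<open>As \<open>r\<close> divides \<open>M\<close>, reducing the digit modulo
          \<open>M\<close> does not disturb its residue modulo \<open>r\<close>. Scaling that
          congruence by \<open>N ^ s\<close> makes it one modulo \<open>M\<close>.\<close>
        have "r dvd M" by (simp add: M)
        then have "digit M s (n + M ^ s * r) mod r = digit M s n mod r"
          using assms(1) by (simp add: digit_add_mult_power mod_mod_cancel) (simp add: digit_def mod_mod_cancel)
        then show ?thesis unfolding 2 by (simp add: cong_def M flip: mult_mod_left)
      qed
    qed
    also have "[(\<Sum>i<Suc s. digit M i n * N ^ i) = base_shift M N n] (mod M)"
      by (rule cong_sym, rule base_shift_cong_sum) fact+
    finally show ?thesis .
  qed
  with \<open>r > 0\<close> assms(1) show ?thesis by (simp add: is_period_def cong_def)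
qed

theorem theorem2p2:
  fixes p a b M N t e :: nat
  assumes "prime p" and "a \<ge> 1" and "b \<ge> 1"
    and "M = p ^ a" and "N = p ^ b"
    and "t = nat \<lceil>real a / real b\<rceil>"
    and "e = a * t - b * (t - 1)"
  shows "purely_periodic (\<lambda>n. base_shift M N n mod M)
       \<and> minimal_period (\<lambda>n. base_shift M N n mod M) = p ^ e"
proof -
  define f where "f = (\<lambda>n. base_shift M N n mod M)"
  have p: "p \<ge> 2" using \<open>prime p\<close> by (rule prime_ge_2_nat)
  have "p ^ 1 \<le> p ^ a" using p \<open>a \<ge> 1\<close> by (intro power_increasing) auto
  with p have M2: "M \<ge> 2" by (simp add: \<open>M = p ^ a\<close>)
  have "real a / real b > 0" using assms(2,3) by simp
  then have "\<lceil>real a / real b\<rceil> > 0" by simp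
  \<comment> \<open>\<open>s = t - 1\<close> is the last digit position that matters: the ceiling
    bounds become \<open>b * s < a \<le> b * Suc s\<close>, so \<open>M\<close> divides
    \<open>N ^ Suc s\<close> but not \<open>N ^ s\<close>.\<close>
  then obtain s where s: "t = Suc s" "\<lceil>real a / real b\<rceil> = int (Suc s)"
    using assms(6) by (metis gr0_implies_Suc nat_0_le order_less_imp_le zero_less_nat_eq)
  then have "real s < real a / real b" "real a / real b \<le> real (Suc s)"
    by (simp_all add: ceiling_eq_iff)
  then have "real (b * s) < real a" "real a \<le> real (b * Suc s)"
    using assms(3) by (simp_all add: field_simps)
  then have bs: "b * s < a" "a \<le> b * Suc s" by (simp_all only: of_nat_less_iff of_nat_le_iff)
  \<comment> \<open>Chosen so that \<open>p ^ Suc c\<close> is the cofactor of \<open>N ^ s\<close>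
    in \<open>M\<close>; the subtraction does not truncate because \<open>b * s < a\<close>.\<close>
  define c where "c = a - b * s - 1"
  have a: "a = Suc c + b * s" using bs by (simp add: c_def)
  have e: "e = Suc (a * s + c)" using a by (simp add: assms(7) s(1))
  have "is_period f (M ^ s * p ^ Suc c)"
    unfolding f_def
  proof (rule base_shift_period[OF M2])
    show "M = p ^ Suc c * N ^ s"
      by (simp only: assms(4,5) a power_add power_mult)
    show "M dvd N ^ Suc s"
      unfolding assms(4,5) power_mult[symmetric] using bs(2) by (rule le_imp_power_dvd)
  qed
  then have period: "is_period f (p ^ Suc (a * s + c))"
    by (simp add: assms(4) power_add power_mult mult.left_commute)
  have "p ^ c < M" unfolding assms(4) using p a by (intro power_strict_increasing) auto
  then have "base_shift M N (M ^ s * p ^ c) = p ^ (c + b * s)"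
    using base_shift_power_mult M2 by (simp add: assms(5) power_add power_mult)
  \<comment> \<open>The exponent is \<open>a - 1\<close>, so reduction modulo \<open>M\<close>
    leaves this value unchanged and nonzero.\<close>
  moreover have "p ^ (c + b * s) < M"
    unfolding assms(4) using p a by (intro power_strict_increasing) auto
  \<comment> \<open>The \<open>0 +\<close> matches the periodicity equation at
    \<open>n = 0\<close>.\<close>
  ultimately have "f (0 + p ^ (a * s + c)) \<noteq> 0"
    using p by (simp add: f_def assms(4) power_add power_mult)
  moreover have "f 0 = 0"
    using base_shift_power_mult[of 0 M N 0] M2 by (simp add: f_def)
  ultimately have "\<not> is_period f (p ^ (a * s + c))"
    unfolding is_period_def by (metis gr0I)
  then have "minimal_period f = p ^ e"
    unfolding e by (rule minimal_period_prime_power[OF \<open>prime p\<close> period])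
  then show ?thesis using period unfolding purely_periodic_def f_def by blast
qed

end
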